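(* Let $(\mathbf{Vect},\oplus,0)$ be the symmetric monoidal category of (not necessarily finite dimensional) vector spaces and linear maps with direct sum as tensor. For a linear map $f:V\oplus U\to W\oplus U$ with components $f_{11}:V\to W$, $f_{12}:U\to W$, $f_{21}:V\to U$, $f_{22}:U\to U$, declare $\mathrm{Tr}^U_{V,W}(f)$ to be defined if and only if $$\mathrm{im}\,f_{21}\subseteq\mathrm{im}(I-f_{22})\quad\text{and}\quad\ker(I-f_{22})\subseteq\ker f_{12},$$ where $I$ is the identity of $U$; in that case let $\mathrm{Tr}^U_{V,W}(f):V\to W$ be $$\mathrm{Tr}^U_{V,W}(f)(v)=f_{11}(v)+f_{12}(u)\quad\text{for some }u\in U\text{ with }(I-f_{22})(u)=f_{21}(v)$$ (this does not depend on the choice of $u$). Then $\mathrm{Tr}$ is a partial trace on $(\mathbf{Vect},\oplus,0)$.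
   Context: Vector spaces are over a fixed field. For partially defined expressions, $a\simeq b$ (Kleene equality) means that $a,b$ are either both undefined, or both defined and equal; $a\lesssim b$ means that either $a$ is undefined, or both are defined and equal. A partial trace on a symmetric monoidal category $(\mathcal{C},\otimes,I,\rho,\lambda,\sigma)$ is a family of partial functions $\mathrm{Tr}^U_{X,Y}:\mathcal{C}(X\otimes U,Y\otimes U)\rightharpoonup\mathcal{C}(X,Y)$ satisfying (associativity isomorphisms suppressed): - Naturality: for $f:X\otimes U\to Y\otimes U$, $g:X'\to X$, $h:Y\to Y'$: $h\,\mathrm{Tr}^U_{X,Y}(f)\,g\lesssim \mathrm{Tr}^U_{X',Y'}((h\otimes 1_U)f(g\otimes 1_U))$. - Dinaturality: for $f:X\otimes U\to Y\otimes U'$, $g:U'\to U$: $\mathrm{Tr}^U_{X,Y}((1_Y\otimes g)f)\simeq \mathrm{Tr}^{U'}_{X,Y}(f(1_X\otimes g))$. - Vanishing I: for $f:X\otimes I\to Y\otimes I$: $\mathrm{Tr}^I_{X,Y}(f)\simeq\rho_Y f\rho_X^{-1}$, where $\rho_X:X\otimes I\to X$. - Vanishing II: for $g:X\otimes U\otimes V\to Y\otimes U\otimes V$, if $\mathrm{Tr}^V_{X\otimes U,Y\otimes U}(g)$ is defined then $\mathrm{Tr}^{U\otimes V}_{X,Y}(g)\simeq\mathrm{Tr}^U_{X,Y}(\mathrm{Tr}^V_{X\otimes U,Y\otimes U}(g))$. - Superposing: for $f:X\otimes U\to Y\otimes U$, $g:W\to Z$: $g\otimes\mathrm{Tr}^U_{X,Y}(f)\lesssim\mathrm{Tr}^U_{W\otimes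 X,Z\otimes Y}(g\otimes f)$. - Yanking: $\mathrm{Tr}^U_{U,U}(\sigma_{U,U})\simeq 1_U$. Here $\otimes$ is $\oplus$ and the unit is $0$. *)

theory Defs
  imports "HOL-Algebra.AbelCoset" "Jordan_Normal_Form.Missing_VectorSpace"
begin

section \<open>Symmetric monoidal categories\<close>

record ('o, 'm) cat =
  Ob :: "'o set"
  Ar :: "'m set"
  Dom :: "'m \<Rightarrow> 'o"
  Cod :: "'m \<Rightarrow> 'o"
  ident :: "'o \<Rightarrow> 'm"
  comp_ar :: "'m \<Rightarrow> 'm \<Rightarrow> 'm"  (infixl \<open>\<cdot>\<index>\<close> 65)

text \<open>\<open>g \<cdot> f\<close> is composition in the applicative order: first \<open>f\<close>, then \<open>g\<close>.\<close>

record ('o, 'm) smcat = "('o, 'm) cat" +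
  tensor_ob :: "'o \<Rightarrow> 'o \<Rightarrow> 'o"  (infixl \<open>\<boxtimes>\<index>\<close> 75)
  tensor_ar :: "'m \<Rightarrow> 'm \<Rightarrow> 'm"  (infixl \<open>\<boxdot>\<index>\<close> 75)
  unit_ob :: 'o
  associator :: "'o \<Rightarrow> 'o \<Rightarrow> 'o \<Rightarrow> 'm"
  lunitor :: "'o \<Rightarrow> 'm"
  runitor :: "'o \<Rightarrow> 'm"
  symmetry :: "'o \<Rightarrow> 'o \<Rightarrow> 'm"

definition homset :: "('o, 'm, 'x) cat_scheme \<Rightarrow> 'o \<Rightarrow> 'o \<Rightarrow> 'm set" where
  "homset C X Y = {f \<in> Ar C. Dom C f = X \<and> Cod C f = Y}"

definition inverse_ar_of :: "('o, 'm, 'x) cat_scheme \<Rightarrow> 'm \<Rightarrow> 'm \<Rightarrow> bool" where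
  "inverse_ar_of C f g \<longleftrightarrow> g \<in> homset C (Cod C f) (Dom C f) \<and>
     comp_ar C g f = ident C (Dom C f) \<and> comp_ar C f g = ident C (Cod C f)"

definition iso_ar :: "('o, 'm, 'x) cat_scheme \<Rightarrow> 'm \<Rightarrow> bool" where
  "iso_ar C f \<longleftrightarrow> f \<in> Ar C \<and> (\<exists>g. inverse_ar_of C f g)"

definition inv_ar :: "('o, 'm, 'x) cat_scheme \<Rightarrow> 'm \<Rightarrow> 'm" where
  "inv_ar C f = (THE g. inverse_ar_of C f g)"

locale category =
  fixes C :: "('o, 'm, 'x) cat_scheme" (structure)
  assumes Dom_Ob: "f \<in> Ar C \<Longrightarrow> Dom C f \<in> Ob C"
    and Cod_Ob: "f \<in> Ar C \<Longrightarrow> Cod C f \<in> Ob C"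
    and ident_hom: "X \<in> Ob C \<Longrightarrow> ident C X \<in> homset C X X"
    and comp_hom: "\<lbrakk>f \<in> homset C X Y; g \<in> homset C Y Z\<rbrakk> \<Longrightarrow> g \<cdot> f \<in> homset C X Z"
    and comp_ident_left: "f \<in> homset C X Y \<Longrightarrow> ident C Y \<cdot> f = f"
    and comp_ident_right: "f \<in> homset C X Y \<Longrightarrow> f \<cdot> ident C X = f"
    and comp_assoc: "\<lbrakk>f \<in> homset C W X; g \<in> homset C X Y; h \<in> homset C Y Z\<rbrakk>
      \<Longrightarrow> (h \<cdot> g) \<cdot> f = h \<cdot> (g \<cdot> f)"

locale symmetric_monoidal_category = category C
  for C :: "('o, 'm, 'x) smcat_scheme" (structure) +
  assumes tensor_Ob: "\<lbrakk>X \<in> Ob C; Y \<in> Ob C\<rbrakk> \<Longrightarrow> X \<boxtimes> Y \<in> Ob C"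
    and unit_Ob: "unit_ob C \<in> Ob C"
    and tensor_hom: "\<lbrakk>f \<in> homset C X Y; g \<in> homset C X' Y'\<rbrakk>
      \<Longrightarrow> f \<boxdot> g \<in> homset C (X \<boxtimes> X') (Y \<boxtimes> Y')"
    and tensor_ident: "\<lbrakk>X \<in> Ob C; Y \<in> Ob C\<rbrakk>
      \<Longrightarrow> ident C X \<boxdot> ident C Y = ident C (X \<boxtimes> Y)"
    and tensor_comp: "\<lbrakk>f \<in> homset C X Y; g \<in> homset C Y Z; f' \<in> homset C X' Y'; g' \<in> homset C Y' Z'\<rbrakk>
      \<Longrightarrow> (g \<cdot> f) \<boxdot> (g' \<cdot> f') = (g \<boxdot> g') \<cdot> (f \<boxdot> f')"
    and associator_hom: "\<lbrakk>X \<in> Ob C; Y \<in> Ob C; Z \<in> Ob C\<rbrakk>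
      \<Longrightarrow> associator C X Y Z \<in> homset C ((X \<boxtimes> Y) \<boxtimes> Z) (X \<boxtimes> (Y \<boxtimes> Z))"
    and associator_iso: "\<lbrakk>X \<in> Ob C; Y \<in> Ob C; Z \<in> Ob C\<rbrakk> \<Longrightarrow> iso_ar C (associator C X Y Z)"
    and associator_natural: "\<lbrakk>f \<in> homset C X X'; g \<in> homset C Y Y'; h \<in> homset C Z Z'\<rbrakk>
      \<Longrightarrow> associator C X' Y' Z' \<cdot> ((f \<boxdot> g) \<boxdot> h) = (f \<boxdot> (g \<boxdot> h)) \<cdot> associator C X Y Z"
    and lunitor_hom: "X \<in> Ob C \<Longrightarrow> lunitor C X \<in> homset C (unit_ob C \<boxtimes> X) X"
    and lunitor_iso: "X \<in> Ob C \<Longrightarrow> iso_ar C (lunitor C X)"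
    and lunitor_natural: "f \<in> homset C X Y
      \<Longrightarrow> lunitor C Y \<cdot> (ident C (unit_ob C) \<boxdot> f) = f \<cdot> lunitor C X"
    and runitor_hom: "X \<in> Ob C \<Longrightarrow> runitor C X \<in> homset C (X \<boxtimes> unit_ob C) X"
    and runitor_iso: "X \<in> Ob C \<Longrightarrow> iso_ar C (runitor C X)"
    and runitor_natural: "f \<in> homset C X Y
      \<Longrightarrow> runitor C Y \<cdot> (f \<boxdot> ident C (unit_ob C)) = f \<cdot> runitor C X"
    and symmetry_hom: "\<lbrakk>X \<in> Ob C; Y \<in> Ob C\<rbrakk>
      \<Longrightarrow> symmetry C X Y \<in> homset C (X \<boxtimes> Y) (Y \<boxtimes> X)"
    and symmetry_natural: "\<lbrakk>f \<in> homset C X X'; g \<in> homset C Y Y'\<rbrakk>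
      \<Longrightarrow> symmetry C X' Y' \<cdot> (f \<boxdot> g) = (g \<boxdot> f) \<cdot> symmetry C X Y"
    and symmetry_involutive: "\<lbrakk>X \<in> Ob C; Y \<in> Ob C\<rbrakk>
      \<Longrightarrow> symmetry C Y X \<cdot> symmetry C X Y = ident C (X \<boxtimes> Y)"
    and pentagon: "\<lbrakk>W \<in> Ob C; X \<in> Ob C; Y \<in> Ob C; Z \<in> Ob C\<rbrakk>
      \<Longrightarrow> associator C W X (Y \<boxtimes> Z) \<cdot> associator C (W \<boxtimes> X) Y Z =
        (ident C W \<boxdot> associator C X Y Z) \<cdot> associator C W (X \<boxtimes> Y) Z
          \<cdot> (associator C W X Y \<boxdot> ident C Z)"
    and triangle: "\<lbrakk>X \<in> Ob C; Y \<in> Ob C\<rbrakk>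
      \<Longrightarrow> (ident C X \<boxdot> lunitor C Y) \<cdot> associator C X (unit_ob C) Y = runitor C X \<boxdot> ident C Y"
    and hexagon: "\<lbrakk>X \<in> Ob C; Y \<in> Ob C; Z \<in> Ob C\<rbrakk>
      \<Longrightarrow> associator C Y Z X \<cdot> symmetry C X (Y \<boxtimes> Z) \<cdot> associator C X Y Z =
        (ident C Y \<boxdot> symmetry C X Z) \<cdot> associator C Y X Z \<cdot> (symmetry C X Y \<boxdot> ident C Z)"


section \<open>Partial traces\<close>

text \<open>Partially defined expressions have type \<open>option\<close>, with \<open>None\<close> for undefined; Kleene
  equality is then equality, and the directed relation is the following.\<close>

definition kleene_le :: "'a option \<Rightarrow> 'a option \<Rightarrow> bool"  (infix \<open>\<lesssim>\<close> 50) where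
  "a \<lesssim> b \<longleftrightarrow> a = None \<or> a = b"

text \<open>\<open>Tr U X Y f\<close> is the trace of \<open>f : X \<otimes> U \<rightarrow> Y \<otimes> U\<close> along \<open>U\<close>; its values on
  other arguments are irrelevant. The associativity isomorphisms are written out.\<close>

locale partial_trace = symmetric_monoidal_category C
  for C :: "('o, 'm, 'x) smcat_scheme" (structure) +
  fixes Tr :: "'o \<Rightarrow> 'o \<Rightarrow> 'o \<Rightarrow> 'm \<Rightarrow> 'm option"
  assumes trace_hom:
    "\<lbrakk>X \<in> Ob C; Y \<in> Ob C; U \<in> Ob C; f \<in> homset C (X \<boxtimes> U) (Y \<boxtimes> U); Tr U X Y f = Some t\<rbrakk>
      \<Longrightarrow> t \<in> homset C X Y"
    and naturality:
    "\<lbrakk>X \<in> Ob C; Y \<in> Ob C; X' \<in> Ob C; Y' \<in> Ob C; U \<in> Ob C;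
      f \<in> homset C (X \<boxtimes> U) (Y \<boxtimes> U); g \<in> homset C X' X; h \<in> homset C Y Y'\<rbrakk>
      \<Longrightarrow> map_option (\<lambda>t. h \<cdot> t \<cdot> g) (Tr U X Y f)
          \<lesssim> Tr U X' Y' ((h \<boxdot> ident C U) \<cdot> f \<cdot> (g \<boxdot> ident C U))"
    and dinaturality:
    "\<lbrakk>X \<in> Ob C; Y \<in> Ob C; U \<in> Ob C; U' \<in> Ob C;
      f \<in> homset C (X \<boxtimes> U) (Y \<boxtimes> U'); g \<in> homset C U' U\<rbrakk>
      \<Longrightarrow> Tr U X Y ((ident C Y \<boxdot> g) \<cdot> f) = Tr U' X Y (f \<cdot> (ident C X \<boxdot> g))"
    and vanishing_I:
    "\<lbrakk>X \<in> Ob C; Y \<in> Ob C; f \<in> homset C (X \<boxtimes> unit_ob C) (Y \<boxtimes> unit_ob C)\<rbrakk>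
      \<Longrightarrow> Tr (unit_ob C) X Y f = Some (runitor C Y \<cdot> f \<cdot> inv_ar C (runitor C X))"
    and vanishing_II:
    "\<lbrakk>X \<in> Ob C; Y \<in> Ob C; U \<in> Ob C; V \<in> Ob C;
      g \<in> homset C ((X \<boxtimes> U) \<boxtimes> V) ((Y \<boxtimes> U) \<boxtimes> V); Tr V (X \<boxtimes> U) (Y \<boxtimes> U) g = Some t\<rbrakk>
      \<Longrightarrow> Tr (U \<boxtimes> V) X Y (associator C Y U V \<cdot> g \<cdot> inv_ar C (associator C X U V)) = Tr U X Y t"
    and superposing:
    "\<lbrakk>X \<in> Ob C; Y \<in> Ob C; U \<in> Ob C; W \<in> Ob C; Z \<in> Ob C;
      f \<in> homset C (X \<boxtimes> U) (Y \<boxtimes> U); g \<in> homset C W Z\<rbrakk>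
      \<Longrightarrow> map_option (\<lambda>t. g \<boxdot> t) (Tr U X Y f)
          \<lesssim> Tr U (W \<boxtimes> X) (Z \<boxtimes> Y)
               (inv_ar C (associator C Z Y U) \<cdot> (g \<boxdot> f) \<cdot> associator C W X U)"
    and yanking:
    "U \<in> Ob C \<Longrightarrow> Tr U U U (symmetry C U U) = Some (ident C U)"


section \<open>Vector spaces with direct sum\<close>

text \<open>All objects of a category must have carriers in one type, which has to be closed under
  pairing for the direct sum to be an operation on objects. The type \<open>'b univ\<close> is the closure of
  an arbitrary type \<open>'b\<close> (via \<open>Atom\<close>) under pairs, together with a point for the zero space. So
  every vector space with carrier in \<open>'b\<close>, of any dimension, is isomorphic to an object, and since
  \<open>'b\<close> is arbitrary this covers, up to isomorphism, any given set of vector spaces.\<close>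

datatype 'b univ = Atom 'b | Point | UPair (ufst: "'b univ") (usnd: "'b univ")

type_synonym ('a, 'b) vspace = "('a, 'b univ) module"

text \<open>\<open>zero_space\<close> and \<open>vsum\<close> (the library's \<open>direct_sum\<close>, carried from pairs to \<open>UPair\<close>) have to
  fill in the fields \<open>mult\<close> and \<open>one\<close>, which the record type inherits from rings and which play
  no role in a vector space.\<close>

definition zero_space :: "('a, 'b) vspace" where
  "zero_space = \<lparr>carrier = {Point}, mult = (\<lambda>_ _. Point), one = Point,
     zero = Point, add = (\<lambda>_ _. Point), smult = (\<lambda>_ _. Point)\<rparr>"

definition enc :: "'b univ \<times> 'b univ \<Rightarrow> 'b univ" where
  "enc p = UPair (fst p) (snd p)"

definition dec :: "'b univ \<Rightarrow> 'b univ \<times> 'b univ" where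
  "dec x = (ufst x, usnd x)"

definition vsum :: "('a, 'b) vspace \<Rightarrow> ('a, 'b) vspace \<Rightarrow> ('a, 'b) vspace" where
  "vsum V W = (let D = direct_sum V W in
     \<lparr>carrier = enc ` carrier D,
      mult = (\<lambda>x y. enc (dec x \<otimes>\<^bsub>D\<^esub> dec y)),
      one = enc \<one>\<^bsub>D\<^esub>,
      zero = enc \<zero>\<^bsub>D\<^esub>,
      add = (\<lambda>x y. enc (dec x \<oplus>\<^bsub>D\<^esub> dec y)),
      smult = (\<lambda>c x. enc (c \<odot>\<^bsub>D\<^esub> dec x))\<rparr>)"

text \<open>An arrow carries its source and target; its underlying function is taken to be
  \<open>undefined\<close> outside the carrier of the source, so that equality of arrows is equality of maps.\<close>

datatype ('a, 'b) arrow =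
  Arrow (src: "('a, 'b) vspace") (tgt: "('a, 'b) vspace") (fn: "'b univ \<Rightarrow> 'b univ")

definition linear_arrows :: "('a, 'c) ring_scheme \<Rightarrow> ('a, 'b) arrow set" where
  "linear_arrows K = {Arrow V W f | V W f. linear_map K V W f \<and> f \<in> extensional (carrier V)}"

definition Vect :: "('a, 'c) ring_scheme \<Rightarrow> (('a, 'b) vspace, ('a, 'b) arrow) smcat" where
  "Vect K = \<lparr>
     Ob = {V. vectorspace K V},
     Ar = linear_arrows K,
     Dom = src,
     Cod = tgt,
     ident = (\<lambda>V. Arrow V V (\<lambda>v\<in>carrier V. v)),
     comp_ar = (\<lambda>g f. Arrow (src f) (tgt g) (compose (carrier (src f)) (fn g) (fn f))),
     tensor_ob = vsum,
     tensor_ar = (\<lambda>f g. Arrow (vsum (src f) (src g)) (vsum (tgt f) (tgt g))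
       (\<lambda>x\<in>carrier (vsum (src f) (src g)). UPair (fn f (ufst x)) (fn g (usnd x)))),
     unit_ob = zero_space,
     associator = (\<lambda>U V W. Arrow (vsum (vsum U V) W) (vsum U (vsum V W))
       (\<lambda>x\<in>carrier (vsum (vsum U V) W). UPair (ufst (ufst x)) (UPair (usnd (ufst x)) (usnd x)))),
     lunitor = (\<lambda>V. Arrow (vsum zero_space V) V (\<lambda>x\<in>carrier (vsum zero_space V). usnd x)),
     runitor = (\<lambda>V. Arrow (vsum V zero_space) V (\<lambda>x\<in>carrier (vsum V zero_space). ufst x)),
     symmetry = (\<lambda>V W. Arrow (vsum V W) (vsum W V)
       (\<lambda>x\<in>carrier (vsum V W). UPair (usnd x) (ufst x)))\<rparr>"


section \<open>The trace on vector spaces\<close>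

text \<open>Components of \<open>f : V \<oplus> U \<rightarrow> W \<oplus> U\<close>:
  \<open>f\<^sub>1\<^sub>1 : V \<rightarrow> W\<close>, \<open>f\<^sub>1\<^sub>2 : U \<rightarrow> W\<close>, \<open>f\<^sub>2\<^sub>1 : V \<rightarrow> U\<close>, \<open>f\<^sub>2\<^sub>2 : U \<rightarrow> U\<close>.\<close>

definition comp11 :: "('a, 'b) vspace \<Rightarrow> ('a, 'b) arrow \<Rightarrow> 'b univ \<Rightarrow> 'b univ" where
  "comp11 U f v = ufst (fn f (UPair v \<zero>\<^bsub>U\<^esub>))"

definition comp12 :: "('a, 'b) vspace \<Rightarrow> ('a, 'b) arrow \<Rightarrow> 'b univ \<Rightarrow> 'b univ" where
  "comp12 V f u = ufst (fn f (UPair \<zero>\<^bsub>V\<^esub> u))"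

definition comp21 :: "('a, 'b) vspace \<Rightarrow> ('a, 'b) arrow \<Rightarrow> 'b univ \<Rightarrow> 'b univ" where
  "comp21 U f v = usnd (fn f (UPair v \<zero>\<^bsub>U\<^esub>))"

definition comp22 :: "('a, 'b) vspace \<Rightarrow> ('a, 'b) arrow \<Rightarrow> 'b univ \<Rightarrow> 'b univ" where
  "comp22 V f u = usnd (fn f (UPair \<zero>\<^bsub>V\<^esub> u))"

definition id_minus_comp22 ::
    "('a, 'b) vspace \<Rightarrow> ('a, 'b) vspace \<Rightarrow> ('a, 'b) arrow \<Rightarrow> 'b univ \<Rightarrow> 'b univ" where
  "id_minus_comp22 U V f u = u \<ominus>\<^bsub>U\<^esub> comp22 V f u"

definition vtrace_defined ::
    "('a, 'b) vspace \<Rightarrow> ('a, 'b) vspace \<Rightarrow> ('a, 'b) vspace \<Rightarrow> ('a, 'b) arrow \<Rightarrow> bool" where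
  "vtrace_defined U V W f \<longleftrightarrow>
     comp21 U f ` carrier V \<subseteq> id_minus_comp22 U V f ` carrier U \<and>
     a_kernel U U (id_minus_comp22 U V f) \<subseteq> a_kernel U W (comp12 V f)"

definition vtrace ::
    "('a, 'b) vspace \<Rightarrow> ('a, 'b) vspace \<Rightarrow> ('a, 'b) vspace \<Rightarrow> ('a, 'b) arrow \<Rightarrow> ('a, 'b) arrow option"
  where
  "vtrace U V W f =
     (if vtrace_defined U V W f then
        Some (Arrow V W (\<lambda>v\<in>carrier V. comp11 U f v \<oplus>\<^bsub>W\<^esub>
          comp12 V f (SOME u. u \<in> carrier U \<and> id_minus_comp22 U V f u = comp21 U f v)))
      else None)"

end

theory Submission
  imports Defs
begin

text \<open>For \<open>f : V \<oplus> U \<rightarrow> W \<oplus> U\<close> consider the linear relation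
  \<open>R\<^sub>f = {(v, w). \<exists>u. f (v, u) = (w, u)}\<close> between \<open>V\<close> and \<open>W\<close>. The condition
  \<open>im f\<^sub>2\<^sub>1 \<subseteq> im (I - f\<^sub>2\<^sub>2)\<close> says that \<open>R\<^sub>f\<close> is total, and
  \<open>ker (I - f\<^sub>2\<^sub>2) \<subseteq> ker f\<^sub>1\<^sub>2\<close> says that it is single-valued. So the trace of \<open>f\<close> is
  defined exactly when \<open>R\<^sub>f\<close> is the graph of a linear map, and is then that map. In this form
  every axiom of a partial trace is an elementary statement about feedback relations.\<close>

section \<open>Direct sums and the zero space\<close>

lemma vsum_carrier_iff [simp]:
  "UPair a b \<in> carrier (vsum V W) \<longleftrightarrow> a \<in> carrier V \<and> b \<in> carrier W"
  by (force simp: vsum_def Let_def direct_sum_def enc_def)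

lemma vsum_carrierE [elim!]:
  assumes "x \<in> carrier (vsum V W)"
  obtains a b where "x = UPair a b" "a \<in> carrier V" "b \<in> carrier W"
  using assms by (auto simp: vsum_def Let_def direct_sum_def enc_def)

text \<open>Splits a feedback value in a direct sum into two nested ones, as vanishing II
  requires.\<close>

lemma Bex_vsum [simp]:
  "(\<exists>x\<in>carrier (vsum V W). P x) \<longleftrightarrow> (\<exists>a\<in>carrier V. \<exists>b\<in>carrier W. P (UPair a b))"
  by (metis vsum_carrierE vsum_carrier_iff)

lemma vsum_carrierD:
  assumes "x \<in> carrier (vsum V W)"
  shows "ufst x \<in> carrier V" "usnd x \<in> carrier W"
  using assms by auto

lemma vsum_simps [simp]:
  "\<zero>\<^bsub>vsum V W\<^esub> = UPair \<zero>\<^bsub>V\<^esub> \<zero>\<^bsub>W\<^esub>"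
  "UPair a b \<oplus>\<^bsub>vsum V W\<^esub> UPair c d = UPair (a \<oplus>\<^bsub>V\<^esub> c) (b \<oplus>\<^bsub>W\<^esub> d)"
  "k \<odot>\<^bsub>vsum V W\<^esub> UPair a b = UPair (k \<odot>\<^bsub>V\<^esub> a) (k \<odot>\<^bsub>W\<^esub> b)"
  by (simp_all add: vsum_def Let_def direct_sum_def enc_def dec_def)

lemma zero_space_simps [simp]:
  "carrier zero_space = {Point}" "\<zero>\<^bsub>zero_space\<^esub> = Point"
  "x \<oplus>\<^bsub>zero_space\<^esub> y = Point" "k \<odot>\<^bsub>zero_space\<^esub> x = Point"
  by (simp_all add: zero_space_def)

lemma vectorspace_zero_space: "field K \<Longrightarrow> vectorspace K zero_space"
  by (rule vs_criteria) simp_all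

lemma vectorspace_vsum:
  assumes "vectorspace K V" "vectorspace K W"
  shows "vectorspace K (vsum V W)"
proof -
  interpret V: vectorspace K V by fact
  interpret W: vectorspace K W by fact
  show ?thesis
  proof (rule vs_criteria)
    show "field K" ..
    show "\<forall>v\<in>carrier (vsum V W). \<exists>n\<in>carrier (vsum V W). v \<oplus>\<^bsub>vsum V W\<^esub> n = \<zero>\<^bsub>vsum V W\<^esub>"
    proof
      fix v assume "v \<in> carrier (vsum V W)"
      then obtain a b where v: "v = UPair a b" "a \<in> carrier V" "b \<in> carrier W" ..
      then have "UPair (\<ominus>\<^bsub>V\<^esub> a) (\<ominus>\<^bsub>W\<^esub> b) \<in> carrier (vsum V W)"
        "v \<oplus>\<^bsub>vsum V W\<^esub> UPair (\<ominus>\<^bsub>V\<^esub> a) (\<ominus>\<^bsub>W\<^esub> b) = \<zero>\<^bsub>vsum V W\<^esub>"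
        by (simp_all add: V.r_neg W.r_neg)
      then show "\<exists>n\<in>carrier (vsum V W). v \<oplus>\<^bsub>vsum V W\<^esub> n = \<zero>\<^bsub>vsum V W\<^esub>" ..
    qed
  qed (auto simp: V.a_ac W.a_ac V.smult_assoc1 W.smult_assoc1
        V.smult_l_distr W.smult_l_distr V.smult_r_distr W.smult_r_distr)
qed

section \<open>Arrows of \<open>Vect\<close> as linear maps on carriers\<close>

lemma linear_map_iff:
  "linear_map K V W h \<longleftrightarrow> vectorspace K V \<and> vectorspace K W \<and> h \<in> module_hom K V W"
  by (auto simp: linear_map_def mod_hom_def mod_hom_axioms_def vectorspace_def)

lemma Vect_simps [simp]:
  "Ob (Vect K) = {V. vectorspace K V}"
  "Ar (Vect K) = linear_arrows K"
  "Dom (Vect K) = src"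
  "Cod (Vect K) = tgt"
  "ident (Vect K) V = Arrow V V (\<lambda>v\<in>carrier V. v)"
  "comp_ar (Vect K) g f = Arrow (src f) (tgt g) (\<lambda>x\<in>carrier (src f). fn g (fn f x))"
  "tensor_ob (Vect K) = vsum"
  "tensor_ar (Vect K) f g = Arrow (vsum (src f) (src g)) (vsum (tgt f) (tgt g))
       (\<lambda>x\<in>carrier (vsum (src f) (src g)). UPair (fn f (ufst x)) (fn g (usnd x)))"
  "unit_ob (Vect K) = zero_space"
  "associator (Vect K) U V W = Arrow (vsum (vsum U V) W) (vsum U (vsum V W))
       (\<lambda>x\<in>carrier (vsum (vsum U V) W). UPair (ufst (ufst x)) (UPair (usnd (ufst x)) (usnd x)))"
  "lunitor (Vect K) V = Arrow (vsum zero_space V) V (\<lambda>x\<in>carrier (vsum zero_space V). usnd x)"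
  "runitor (Vect K) V = Arrow (vsum V zero_space) V (\<lambda>x\<in>carrier (vsum V zero_space). ufst x)"
  "symmetry (Vect K) V W = Arrow (vsum V W) (vsum W V)
       (\<lambda>x\<in>carrier (vsum V W). UPair (usnd x) (ufst x))"
  by (simp_all add: Vect_def compose_def)

text \<open>Rewriting with these two equations alone changes the objects in a typing statement and
  leaves composites of arrows folded.\<close>

lemmas tensor_ob_Vect = Vect_simps(7)
lemmas unit_ob_Vect = Vect_simps(9)

lemma homset_Vect:
  "homset (Vect K) V W = {Arrow V W h |h. vectorspace K V \<and> vectorspace K W \<and>
     h \<in> module_hom K V W \<and> h \<in> extensional (carrier V)}"
  by (auto simp: homset_def linear_arrows_def linear_map_iff)

lemma homset_VectE:
  assumes "f \<in> homset (Vect K) V W"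
  obtains h where "f = Arrow V W h" "vectorspace K V" "vectorspace K W"
    "h \<in> extensional (carrier V)"
    "\<And>x. x \<in> carrier V \<Longrightarrow> h x \<in> carrier W"
    "\<And>x y. x \<in> carrier V \<Longrightarrow> y \<in> carrier V \<Longrightarrow> h (x \<oplus>\<^bsub>V\<^esub> y) = h x \<oplus>\<^bsub>W\<^esub> h y"
    "\<And>k x. k \<in> carrier K \<Longrightarrow> x \<in> carrier V \<Longrightarrow> h (k \<odot>\<^bsub>V\<^esub> x) = k \<odot>\<^bsub>W\<^esub> h x"
  using assms by (auto simp: homset_Vect module_hom_def Pi_iff)

text \<open>Closure facts taken out of the locale, so that automation can use them for several
  spaces at once without interpretations.\<close>

lemma vectorspace_closed:
  assumes "vectorspace K V"
  shows "\<zero>\<^bsub>V\<^esub> \<in> carrier V"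
    and "x \<in> carrier V \<Longrightarrow> y \<in> carrier V \<Longrightarrow> x \<oplus>\<^bsub>V\<^esub> y \<in> carrier V"
    and "k \<in> carrier K \<Longrightarrow> x \<in> carrier V \<Longrightarrow> k \<odot>\<^bsub>V\<^esub> x \<in> carrier V"
proof -
  interpret vectorspace K V by fact
  show "\<zero>\<^bsub>V\<^esub> \<in> carrier V"
    and "x \<in> carrier V \<Longrightarrow> y \<in> carrier V \<Longrightarrow> x \<oplus>\<^bsub>V\<^esub> y \<in> carrier V"
    and "k \<in> carrier K \<Longrightarrow> x \<in> carrier V \<Longrightarrow> k \<odot>\<^bsub>V\<^esub> x \<in> carrier V"
    by auto
qed

text \<open>Since the function is restricted to the carrier, extensionality holds by construction.
  All structural arrows and composites of \<open>Vect\<close> have this shape.\<close>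

lemma homset_VectI:
  assumes "vectorspace K V" "vectorspace K W"
    and "\<forall>x\<in>carrier V. h x \<in> carrier W"
    and "\<forall>x\<in>carrier V. \<forall>y\<in>carrier V. h (x \<oplus>\<^bsub>V\<^esub> y) = h x \<oplus>\<^bsub>W\<^esub> h y"
    and "\<forall>x\<in>carrier V. \<forall>k\<in>carrier K. h (k \<odot>\<^bsub>V\<^esub> x) = k \<odot>\<^bsub>W\<^esub> h x"
  shows "Arrow V W (\<lambda>x\<in>carrier V. h x) \<in> homset (Vect K) V W"
  using assms by (auto simp: homset_Vect module_hom_def vectorspace_closed)

section \<open>The symmetric monoidal category of vector spaces\<close>

text \<open>\<open>inv_ar\<close> is a definite description, so an inverse has to be exhibited
  first. Together with uniqueness in \<open>inv_ar_eqI\<close> this makes \<open>inv_ar\<close>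
  computable on elements.\<close>

lemma inverse_ar_of_associator_Vect:
  assumes "vectorspace K X" "vectorspace K Y" "vectorspace K Z"
  shows "inverse_ar_of (Vect K) (associator (Vect K) X Y Z)
    (Arrow (vsum X (vsum Y Z)) (vsum (vsum X Y) Z) (\<lambda>x\<in>carrier (vsum X (vsum Y Z)).
       UPair (UPair (ufst x) (ufst (usnd x))) (usnd (usnd x))))"
  unfolding inverse_ar_of_def using assms
  by (auto intro!: homset_VectI restrict_ext vectorspace_vsum)

lemma inverse_ar_of_runitor_Vect:
  assumes "field K" "vectorspace K X"
  shows "inverse_ar_of (Vect K) (runitor (Vect K) X)
    (Arrow X (vsum X zero_space) (\<lambda>x\<in>carrier X. UPair x Point))"
  unfolding inverse_ar_of_def using assms
  by (auto intro!: homset_VectI restrict_ext vectorspace_vsum vectorspace_zero_space)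

lemma inverse_ar_of_lunitor_Vect:
  assumes "field K" "vectorspace K X"
  shows "inverse_ar_of (Vect K) (lunitor (Vect K) X)
    (Arrow X (vsum zero_space X) (\<lambda>x\<in>carrier X. UPair Point x))"
  unfolding inverse_ar_of_def using assms
  by (auto intro!: homset_VectI restrict_ext vectorspace_vsum vectorspace_zero_space)

lemma category_Vect:
  fixes K :: "('a, 'c) ring_scheme"
  shows "category (Vect K :: (('a, 'b) vspace, ('a, 'b) arrow) smcat)"
    (is "category ?C")
proof
  fix W X Y Z :: "('a, 'b) vspace" and f g h
  show "f \<in> Ar ?C \<Longrightarrow> Dom ?C f \<in> Ob ?C"
    and "f \<in> Ar ?C \<Longrightarrow> Cod ?C f \<in> Ob ?C"
    by (auto simp: linear_arrows_def linear_map_iff)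
  show "X \<in> Ob ?C \<Longrightarrow> ident ?C X \<in> homset ?C X X"
    by (auto intro!: homset_VectI)
  show "f \<in> homset ?C X Y \<Longrightarrow> g \<in> homset ?C Y Z \<Longrightarrow>
      comp_ar ?C g f \<in> homset ?C X Z"
    by (auto elim!: homset_VectE intro!: homset_VectI)
  show "f \<in> homset ?C X Y \<Longrightarrow> comp_ar ?C (ident ?C Y) f = f"
    and "f \<in> homset ?C X Y \<Longrightarrow> comp_ar ?C f (ident ?C X) = f"
    by (auto elim!: homset_VectE simp: fun_eq_iff restrict_def extensional_def)
  show "f \<in> homset ?C W X \<Longrightarrow> g \<in> homset ?C X Y \<Longrightarrow> h \<in> homset ?C Y Z \<Longrightarrow>
      comp_ar ?C (comp_ar ?C h g) f = comp_ar ?C h (comp_ar ?C g f)"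
    by (auto elim!: homset_VectE intro!: restrict_ext)
qed

text \<open>Inverses are unique by the usual computation g' = g'(fg) = (g'f)g = g.\<close>

lemma (in category) inv_ar_eqI:
  assumes "f \<in> Ar C" "inverse_ar_of C f g"
  shows "inv_ar C f = g"
  unfolding inv_ar_def
proof (rule the_equality)
  fix g' assume g': "inverse_ar_of C f g'"
  have hom: "f \<in> homset C (Dom C f) (Cod C f)"
    using assms(1) by (simp add: homset_def)
  have "g' = g' \<cdot> (f \<cdot> g)"
    using g' assms(2) comp_ident_right unfolding inverse_ar_of_def by metis
  also have "\<dots> = (g' \<cdot> f) \<cdot> g"
    using g' assms(2) comp_assoc hom unfolding inverse_ar_of_def by metis
  also have "\<dots> = g"
    using g' assms(2) comp_ident_left unfolding inverse_ar_of_def by metis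
  finally show "g' = g" .
qed fact

lemma symmetric_monoidal_category_Vect:
  fixes K :: "('a, 'c) ring_scheme"
  assumes "field K"
  shows "symmetric_monoidal_category (Vect K :: (('a, 'b) vspace, ('a, 'b) arrow) smcat)"
    (is "symmetric_monoidal_category ?C")
proof -
  interpret category ?C by (rule category_Vect)
  note intros = homset_VectI restrict_ext vectorspace_vsum vectorspace_zero_space assms
  have iso: "iso_ar ?C f" if "f \<in> homset ?C X Y" "inverse_ar_of ?C f g" for f g X Y
    using that by (auto simp: iso_ar_def homset_def)
  have associator_hom: "associator ?C X Y Z \<in> homset ?C (vsum (vsum X Y) Z) (vsum X (vsum Y Z))"
    if "vectorspace K X" "vectorspace K Y" "vectorspace K Z" for X Y Z
    using that by (auto intro!: intros)
  have lunitor_hom: "lunitor ?C X \<in> homset ?C (vsum zero_space X) X" if "vectorspace K X" for X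
    using that by (auto intro!: intros)
  have runitor_hom: "runitor ?C X \<in> homset ?C (vsum X zero_space) X" if "vectorspace K X" for X
    using that by (auto intro!: intros)
  show ?thesis
  proof
    fix X Y Z
    assume "X \<in> Ob ?C" "Y \<in> Ob ?C" "Z \<in> Ob ?C"
    then have "vectorspace K X" "vectorspace K Y" "vectorspace K Z" by simp_all
    then show "iso_ar ?C (associator ?C X Y Z)"
      by (intro iso[OF associator_hom inverse_ar_of_associator_Vect])
  next
    fix X
    assume "X \<in> Ob ?C"
    then have X: "vectorspace K X" by simp
    show "iso_ar ?C (lunitor ?C X)"
      by (rule iso[OF lunitor_hom[OF X] inverse_ar_of_lunitor_Vect[OF assms X]])
    show "iso_ar ?C (runitor ?C X)"
      by (rule iso[OF runitor_hom[OF X] inverse_ar_of_runitor_Vect[OF assms X]])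
  \<comment> \<open>What remains are typing conditions and equations. The equations (functoriality,
    naturality, coherence) are checked pointwise on nested pairs, where both sides rearrange the
    same components.\<close>
  qed (auto elim!: homset_VectE intro!: intros)
qed

section \<open>The feedback relation of a linear map\<close>

lemma (in abelian_group) minus_eq_iff_add_eq:
  assumes "x \<in> carrier G" "y \<in> carrier G" "z \<in> carrier G"
  shows "x \<ominus> y = z \<longleftrightarrow> z \<oplus> y = x"
  using add.inv_solve_right[of z x y] assms by (auto simp: a_minus_def)

text \<open>The map enters as a library linear map \<open>h\<close>, which gives access to the
  lemmas on linear maps. The abbreviation \<open>f\<close> wraps it as an arrow, so that the
  component functions of the trace apply to it.\<close>

locale feedback =
  V: vectorspace K V + W: vectorspace K W + U: vectorspace K U +
  h: linear_map K "vsum V U" "vsum W U" h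
  for K :: "('a, 'c) ring_scheme" and V W U :: "('a, 'b) vspace" and h
begin

abbreviation "f \<equiv> Arrow (vsum V U) (vsum W U) h"
abbreviation "f11 \<equiv> comp11 U f"
abbreviation "f12 \<equiv> comp12 V f"
abbreviation "f21 \<equiv> comp21 U f"
abbreviation "f22 \<equiv> comp22 V f"
abbreviation "d \<equiv> id_minus_comp22 U V f"

text \<open>The matrix form of \<open>h\<close>, obtained by writing (v, u) as (v, 0) + (0, u) and
  using additivity.\<close>

lemma h_UPair:
  assumes "v \<in> carrier V" "u \<in> carrier U"
  shows "h (UPair v u) = UPair (f11 v \<oplus>\<^bsub>W\<^esub> f12 u) (f21 v \<oplus>\<^bsub>U\<^esub> f22 u)"
proof -
  have "h (UPair v u) = h (UPair v \<zero>\<^bsub>U\<^esub>) \<oplus>\<^bsub>vsum W U\<^esub> h (UPair \<zero>\<^bsub>V\<^esub> u)"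
    using assms h.T_add[of "UPair v \<zero>\<^bsub>U\<^esub>" "UPair \<zero>\<^bsub>V\<^esub> u"] by simp
  moreover have "h (UPair v \<zero>\<^bsub>U\<^esub>) \<in> carrier (vsum W U)" "h (UPair \<zero>\<^bsub>V\<^esub> u) \<in> carrier (vsum W U)"
    using assms by (intro h.T_im; simp)+
  ultimately show ?thesis
    by (elim vsum_carrierE) (simp add: comp11_def comp12_def comp21_def comp22_def)
qed

lemma components_closed:
  shows "v \<in> carrier V \<Longrightarrow> f11 v \<in> carrier W" "u \<in> carrier U \<Longrightarrow> f12 u \<in> carrier W"
    and "v \<in> carrier V \<Longrightarrow> f21 v \<in> carrier U" "u \<in> carrier U \<Longrightarrow> f22 u \<in> carrier U"
proof -
  have v: "h (UPair v \<zero>\<^bsub>U\<^esub>) \<in> carrier (vsum W U)" if "v \<in> carrier V"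
    using that by (intro h.T_im; simp)
  have u: "h (UPair \<zero>\<^bsub>V\<^esub> u) \<in> carrier (vsum W U)" if "u \<in> carrier U"
    using that by (intro h.T_im; simp)
  show "v \<in> carrier V \<Longrightarrow> f11 v \<in> carrier W" "v \<in> carrier V \<Longrightarrow> f21 v \<in> carrier U"
    using vsum_carrierD[OF v] by (simp_all add: comp11_def comp21_def)
  show "u \<in> carrier U \<Longrightarrow> f12 u \<in> carrier W" "u \<in> carrier U \<Longrightarrow> f22 u \<in> carrier U"
    using vsum_carrierD[OF u] by (simp_all add: comp12_def comp22_def)
qed

lemma components_zero: "f11 \<zero>\<^bsub>V\<^esub> = \<zero>\<^bsub>W\<^esub>" "f21 \<zero>\<^bsub>V\<^esub> = \<zero>\<^bsub>U\<^esub>"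
proof -
  have "h (UPair \<zero>\<^bsub>V\<^esub> \<zero>\<^bsub>U\<^esub>) = UPair \<zero>\<^bsub>W\<^esub> \<zero>\<^bsub>U\<^esub>"
    using h.T0_is_0 by (simp only: vsum_simps)
  then show "f11 \<zero>\<^bsub>V\<^esub> = \<zero>\<^bsub>W\<^esub>" "f21 \<zero>\<^bsub>V\<^esub> = \<zero>\<^bsub>U\<^esub>"
    by (simp_all only: comp11_def comp21_def arrow.sel univ.sel)
qed

lemma d_eq_iff:
  assumes "u \<in> carrier U" "x \<in> carrier U"
  shows "d u = x \<longleftrightarrow> x \<oplus>\<^bsub>U\<^esub> f22 u = u"
  unfolding id_minus_comp22_def using assms by (intro U.minus_eq_iff_add_eq components_closed)

text \<open>Compare coordinates in \<open>h_UPair\<close>. The second one says that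
  \<open>f21 v\<close> plus \<open>f22 u\<close> equals \<open>u\<close>, which by
  \<open>d_eq_iff\<close> is the equation for \<open>u\<close> in the definition of the trace; the
  first one gives the value of the trace.\<close>

lemma h_fix_iff:
  assumes "v \<in> carrier V" "u \<in> carrier U"
  shows "h (UPair v u) = UPair w u \<longleftrightarrow> d u = f21 v \<and> w = f11 v \<oplus>\<^bsub>W\<^esub> f12 u"
  using assms d_eq_iff[of u "f21 v"] components_closed(3)[of v]
  by (simp only: h_UPair univ.inject) blast

text \<open>Both conditions of the definition are read through \<open>h_fix_iff\<close>.
  Single-valuedness is recorded only over the input 0, where it is the kernel condition;
  \<open>single_valued\<close> extends it to every input by linearity.\<close>

lemma defined_iff:
  "vtrace_defined U V W f \<longleftrightarrow>
    (\<forall>v\<in>carrier V. \<exists>w\<in>carrier W. \<exists>u\<in>carrier U. h (UPair v u) = UPair w u) \<and>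
    (\<forall>u\<in>carrier U. \<forall>w\<in>carrier W. h (UPair \<zero>\<^bsub>V\<^esub> u) = UPair w u \<longrightarrow> w = \<zero>\<^bsub>W\<^esub>)"
proof -
  have "(\<exists>w\<in>carrier W. \<exists>u\<in>carrier U. h (UPair v u) = UPair w u) \<longleftrightarrow>
      f21 v \<in> d ` carrier U" if v: "v \<in> carrier V" for v
  proof
    assume "\<exists>w\<in>carrier W. \<exists>u\<in>carrier U. h (UPair v u) = UPair w u"
    then obtain w u where "u \<in> carrier U" "h (UPair v u) = UPair w u" by blast
    then show "f21 v \<in> d ` carrier U"
      using h_fix_iff[OF v] by (metis imageI)
  next
    assume "f21 v \<in> d ` carrier U"
    then obtain u where u: "u \<in> carrier U" "d u = f21 v" by (metis imageE)
    then have "h (UPair v u) = UPair (f11 v \<oplus>\<^bsub>W\<^esub> f12 u) u"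
      using h_fix_iff[OF v] by blast
    moreover have "f11 v \<oplus>\<^bsub>W\<^esub> f12 u \<in> carrier W"
      using v u by (intro W.a_closed components_closed)
    ultimately show "\<exists>w\<in>carrier W. \<exists>u\<in>carrier U. h (UPair v u) = UPair w u"
      using u by blast
  qed
  then have "f21 ` carrier V \<subseteq> d ` carrier U \<longleftrightarrow>
      (\<forall>v\<in>carrier V. \<exists>w\<in>carrier W. \<exists>u\<in>carrier U. h (UPair v u) = UPair w u)"
    by (simp add: image_subset_iff)
  \<comment> \<open>Over the input 0 both \<open>f11\<close> and \<open>f21\<close> vanish, so the
    feedback values are exactly the kernel elements \<open>u\<close> of \<open>d\<close>, and their
    output is \<open>f12 u\<close>.\<close>
  moreover have "a_kernel U U d \<subseteq> a_kernel U W f12 \<longleftrightarrow>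
      (\<forall>u\<in>carrier U. \<forall>w\<in>carrier W. h (UPair \<zero>\<^bsub>V\<^esub> u) = UPair w u \<longrightarrow> w = \<zero>\<^bsub>W\<^esub>)"
    unfolding a_kernel_def' subset_iff
    by (simp add: h_fix_iff components_zero components_closed cong: ball_cong) blast
  ultimately show ?thesis
    unfolding vtrace_defined_def by simp
qed

text \<open>The feedback relation is a linear subspace: the difference of the two solutions is a
  solution with input 0, whose output must be 0 by \<open>defined_iff\<close>.\<close>

lemma single_valued:
  assumes "vtrace_defined U V W f" "v \<in> carrier V"
    and "u \<in> carrier U" "w \<in> carrier W" "h (UPair v u) = UPair w u"
    and "u' \<in> carrier U" "w' \<in> carrier W" "h (UPair v u') = UPair w' u'"
  shows "w = w'"
proof -
  \<comment> \<open>The difference is written as a sum with the multiple by the scalar -1, so that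
    additivity and homogeneity of \<open>h\<close> apply.\<close>
  let ?k = "\<ominus>\<^bsub>K\<^esub> \<one>\<^bsub>K\<^esub>"
  have k: "?k \<in> carrier K" by simp
  have neg: "?k \<odot>\<^bsub>V\<^esub> v = \<ominus>\<^bsub>V\<^esub> v" "?k \<odot>\<^bsub>W\<^esub> w' = \<ominus>\<^bsub>W\<^esub> w'" "?k \<odot>\<^bsub>U\<^esub> u' = \<ominus>\<^bsub>U\<^esub> u'"
    using assms by (simp_all add: V.smult_l_minus W.smult_l_minus U.smult_l_minus)
  have "h (UPair v u \<oplus>\<^bsub>vsum V U\<^esub> ?k \<odot>\<^bsub>vsum V U\<^esub> UPair v u')
      = UPair w u \<oplus>\<^bsub>vsum W U\<^esub> ?k \<odot>\<^bsub>vsum W U\<^esub> UPair w' u'"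
    using assms k by (subst h.T_add) (auto simp del: vsum_simps)
  then have "h (UPair \<zero>\<^bsub>V\<^esub> (u \<ominus>\<^bsub>U\<^esub> u')) = UPair (w \<ominus>\<^bsub>W\<^esub> w') (u \<ominus>\<^bsub>U\<^esub> u')"
    using assms by (simp add: neg a_minus_def V.r_neg)
  then have "w \<ominus>\<^bsub>W\<^esub> w' = \<zero>\<^bsub>W\<^esub>"
    using assms unfolding defined_iff by (metis U.minus_closed W.minus_closed)
  then show ?thesis
    using assms by (metis W.minus_eq_iff_add_eq W.zero_closed W.l_zero)
qed

text \<open>The chosen feedback value \<open>s v\<close> need not depend linearly on
  \<open>v\<close>. Still, \<open>s v\<close> plus \<open>s v'\<close> is some feedback value for
  the sum of the inputs, and likewise for scalar multiples; since the output does not depend on the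
  feedback value, \<open>T\<close> is linear.\<close>

lemma vtrace_SomeD:
  assumes "vtrace U V W f = Some t"
  shows "t \<in> homset (Vect K) V W"
    and "\<forall>v\<in>carrier V. \<forall>w\<in>carrier W.
      (\<exists>u\<in>carrier U. h (UPair v u) = UPair w u) \<longleftrightarrow> w = fn t v"
proof -
  define s where "s v = (SOME u. u \<in> carrier U \<and> d u = f21 v)" for v
  define T where "T v = f11 v \<oplus>\<^bsub>W\<^esub> f12 (s v)" for v
  have D: "vtrace_defined U V W f" and t: "t = Arrow V W (\<lambda>v\<in>carrier V. T v)"
    using assms by (auto simp: vtrace_def s_def T_def split: if_splits)
  have s: "s v \<in> carrier U \<and> d (s v) = f21 v" if "v \<in> carrier V" for v
  proof -
    have "f21 v \<in> d ` carrier U"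
      using D that unfolding vtrace_defined_def by blast
    then have "\<exists>u. u \<in> carrier U \<and> d u = f21 v" by (metis imageE)
    then show ?thesis unfolding s_def by (rule someI_ex)
  qed
  have T: "T v \<in> carrier W" "h (UPair v (s v)) = UPair (T v) (s v)" if "v \<in> carrier V" for v
  proof -
    show "T v \<in> carrier W"
      using s[OF that] that unfolding T_def by (intro W.a_closed components_closed) blast+
    show "h (UPair v (s v)) = UPair (T v) (s v)"
      using s[OF that] h_fix_iff[OF that] unfolding T_def by blast
  qed
  have T_eqI: "w = T v"
    if "v \<in> carrier V" "w \<in> carrier W" "u \<in> carrier U" "h (UPair v u) = UPair w u" for v w u
    using single_valued[OF D, of v u w "s v" "T v"] that T s by blast
  have "T (v \<oplus>\<^bsub>V\<^esub> v') = T v \<oplus>\<^bsub>W\<^esub> T v'" if "v \<in> carrier V" "v' \<in> carrier V" for v v'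
  proof (rule sym, rule T_eqI)
    show "h (UPair (v \<oplus>\<^bsub>V\<^esub> v') (s v \<oplus>\<^bsub>U\<^esub> s v')) = UPair (T v \<oplus>\<^bsub>W\<^esub> T v') (s v \<oplus>\<^bsub>U\<^esub> s v')"
      using h.T_add[of "UPair v (s v)" "UPair v' (s v')"] that s T by simp
  qed (use that s T in simp_all)
  moreover have "T (k \<odot>\<^bsub>V\<^esub> v) = k \<odot>\<^bsub>W\<^esub> T v" if "v \<in> carrier V" "k \<in> carrier K" for v k
  proof (rule sym, rule T_eqI)
    show "h (UPair (k \<odot>\<^bsub>V\<^esub> v) (k \<odot>\<^bsub>U\<^esub> s v)) = UPair (k \<odot>\<^bsub>W\<^esub> T v) (k \<odot>\<^bsub>U\<^esub> s v)"
      using h.T_smult[of k "UPair v (s v)"] that s T by simp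
  qed (use that s T in simp_all)
  ultimately show "t \<in> homset (Vect K) V W"
    unfolding t using T by (intro homset_VectI V.vectorspace_axioms W.vectorspace_axioms) blast+
  show "\<forall>v\<in>carrier V. \<forall>w\<in>carrier W.
      (\<exists>u\<in>carrier U. h (UPair v u) = UPair w u) \<longleftrightarrow> w = fn t v"
    unfolding t using T_eqI T s by (simp add: Bex_def) blast
qed

text \<open>Conversely, a relation that is the graph of a linear map is total and relates 0 only to
  0, so the trace is defined by \<open>defined_iff\<close>. It then has the same graph as
  \<open>t\<close>.\<close>

lemma vtrace_eq_Some_iff:
  "vtrace U V W f = Some t \<longleftrightarrow> t \<in> homset (Vect K) V W \<and>
    (\<forall>v\<in>carrier V. \<forall>w\<in>carrier W.
      (\<exists>u\<in>carrier U. h (UPair v u) = UPair w u) \<longleftrightarrow> w = fn t v)"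
    (is "_ \<longleftrightarrow> ?hom t \<and> ?graph t")
proof
  assume "vtrace U V W f = Some t"
  then show "?hom t \<and> ?graph t" using vtrace_SomeD by blast
next
  assume t: "?hom t \<and> ?graph t"
  have closed: "fn t v \<in> carrier W" if "v \<in> carrier V" for v
    using t that by (auto elim!: homset_VectE)
  have "linear_map K V W (fn t)"
    using t by (auto simp: homset_Vect linear_map_iff)
  then have "fn t \<zero>\<^bsub>V\<^esub> = \<zero>\<^bsub>W\<^esub>"
    by (intro mod_hom.f0_is_0[of K]) (simp add: linear_map_def)
  \<comment> \<open>For totality the output is \<open>fn t v\<close>. Over the input 0 the graph
    condition forces the output \<open>fn t\<close> takes at 0, which is 0.\<close>
  then have "vtrace_defined U V W f"
    unfolding defined_iff using t closed V.zero_closed by metis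
  then obtain t' where t': "vtrace U V W f = Some t'"
    by (simp add: vtrace_def)
  have "fn t v = fn t' v" if "v \<in> carrier V" for v
    using t vtrace_SomeD(2)[OF t'] closed that by metis
  \<comment> \<open>Both functions are extensional, so agreement on the carrier gives equality of
    arrows.\<close>
  then have "t = t'"
    using t vtrace_SomeD(1)[OF t'] by (auto simp: homset_Vect intro: extensionalityI)
  then show "vtrace U V W f = Some t" using t' by simp
qed

end

section \<open>Traces of arrows described by their graphs\<close>

text \<open>The version for arrows of \<open>Vect\<close>. Through it the axioms are checked without
  components, images or kernels.\<close>

lemma vtrace_eq_Some_iff:
  assumes "vectorspace K V" "vectorspace K W" "vectorspace K U"
    and "f \<in> homset (Vect K) (vsum V U) (vsum W U)"
  shows "vtrace U V W f = Some t \<longleftrightarrow> t \<in> homset (Vect K) V W \<and>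
    (\<forall>v\<in>carrier V. \<forall>w\<in>carrier W.
      (\<exists>u\<in>carrier U. fn f (UPair v u) = UPair w u) \<longleftrightarrow> w = fn t v)"
proof -
  obtain h where f: "f = Arrow (vsum V U) (vsum W U) h"
    and h: "linear_map K (vsum V U) (vsum W U) h"
    using assms(4) by (auto simp: homset_Vect linear_map_iff)
  interpret feedback K V W U h
    using assms h by (simp add: feedback_def)
  show ?thesis
    using vtrace_eq_Some_iff[of t] by (simp add: f)
qed

lemma vtrace_eq_SomeI:
  assumes "vectorspace K V" "vectorspace K W" "vectorspace K U"
    and "f \<in> homset (Vect K) (vsum V U) (vsum W U)" "t \<in> homset (Vect K) V W"
    and "\<And>v w. v \<in> carrier V \<Longrightarrow> w \<in> carrier W \<Longrightarrow>
      (\<exists>u\<in>carrier U. fn f (UPair v u) = UPair w u) \<longleftrightarrow> w = fn t v"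
  shows "vtrace U V W f = Some t"
  using assms by (simp add: vtrace_eq_Some_iff)

text \<open>The feedback relation determines the trace, including whether it is defined. This yields
  the Kleene equalities of dinaturality and vanishing II, where the two feedback spaces
  differ.\<close>

lemma vtrace_eqI:
  assumes "vectorspace K V" "vectorspace K W" "vectorspace K U" "vectorspace K U'"
    and "f \<in> homset (Vect K) (vsum V U) (vsum W U)"
    and "f' \<in> homset (Vect K) (vsum V U') (vsum W U')"
    and "\<And>v w. v \<in> carrier V \<Longrightarrow> w \<in> carrier W \<Longrightarrow>
      (\<exists>u\<in>carrier U. fn f (UPair v u) = UPair w u) \<longleftrightarrow>
      (\<exists>u\<in>carrier U'. fn f' (UPair v u) = UPair w u)"
  shows "vtrace U V W f = vtrace U' V W f'"
proof -
  have "vtrace U V W f = Some t \<longleftrightarrow> vtrace U' V W f' = Some t" for t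
    using assms by (simp add: vtrace_eq_Some_iff)
  then show ?thesis
    by (metis not_Some_eq)
qed

text \<open>By \<open>h_fix_iff\<close> any solution \<open>u\<close> puts the right-hand side into
  relation with \<open>v\<close>, and the graph property leaves only one such output.\<close>

lemma vtrace_apply:
  assumes "vectorspace K V" "vectorspace K W" "vectorspace K U"
    and "f \<in> homset (Vect K) (vsum V U) (vsum W U)" "vtrace U V W f = Some t"
    and "v \<in> carrier V" "u \<in> carrier U" "id_minus_comp22 U V f u = comp21 U f v"
  shows "fn t v = comp11 U f v \<oplus>\<^bsub>W\<^esub> comp12 V f u"
proof -
  obtain h where f: "f = Arrow (vsum V U) (vsum W U) h"
    and h: "linear_map K (vsum V U) (vsum W U) h"
    using assms(4) by (auto simp: homset_Vect linear_map_iff)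
  interpret feedback K V W U h
    using assms h by (simp add: feedback_def)
  let ?w = "f11 v \<oplus>\<^bsub>W\<^esub> f12 u"
  have "h (UPair v u) = UPair ?w u"
    using h_fix_iff assms unfolding f by blast
  moreover have "?w \<in> carrier W"
    using assms by (intro W.a_closed components_closed)
  ultimately show ?thesis
    using vtrace_SomeD(2) assms(5-7) unfolding f by metis
qed

lemma homset_Vect_closed:
  "f \<in> homset (Vect K) V W \<Longrightarrow> x \<in> carrier V \<Longrightarrow> fn f x \<in> carrier W"
  by (auto elim!: homset_VectE)

section \<open>Inverses of the associator and the right unitor\<close>

lemma associator_inverse_Vect:
  assumes "vectorspace K X" "vectorspace K Y" "vectorspace K Z"
  shows "inv_ar (Vect K) (associator (Vect K) X Y Z) =
      Arrow (vsum X (vsum Y Z)) (vsum (vsum X Y) Z) (\<lambda>x\<in>carrier (vsum X (vsum Y Z)).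
        UPair (UPair (ufst x) (ufst (usnd x))) (usnd (usnd x)))" (is "_ = ?g")
    and "inv_ar (Vect K) (associator (Vect K) X Y Z) \<in>
      homset (Vect K) (vsum X (vsum Y Z)) (vsum (vsum X Y) Z)"
proof -
  have "associator (Vect K) X Y Z \<in> Ar (Vect K)"
    using assms by (auto simp: linear_arrows_def linear_map_iff module_hom_def
        vectorspace_vsum vectorspace_closed)
  then show eq: "inv_ar (Vect K) (associator (Vect K) X Y Z) = ?g"
    by (rule category.inv_ar_eqI[OF category_Vect _ inverse_ar_of_associator_Vect[OF assms]])
  show "inv_ar (Vect K) (associator (Vect K) X Y Z) \<in>
      homset (Vect K) (vsum X (vsum Y Z)) (vsum (vsum X Y) Z)"
    unfolding eq using inverse_ar_of_associator_Vect[OF assms] by (simp add: inverse_ar_of_def)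
qed

lemma runitor_inverse_Vect:
  assumes "field K" "vectorspace K X"
  shows "inv_ar (Vect K) (runitor (Vect K) X) =
      Arrow X (vsum X zero_space) (\<lambda>x\<in>carrier X. UPair x Point)" (is "_ = ?g")
    and "inv_ar (Vect K) (runitor (Vect K) X) \<in> homset (Vect K) X (vsum X zero_space)"
proof -
  have "runitor (Vect K) X \<in> Ar (Vect K)"
    using assms by (auto simp: linear_arrows_def linear_map_iff module_hom_def
        vectorspace_vsum vectorspace_zero_space vectorspace_closed)
  then show eq: "inv_ar (Vect K) (runitor (Vect K) X) = ?g"
    by (rule category.inv_ar_eqI[OF category_Vect _ inverse_ar_of_runitor_Vect[OF assms]])
  show "inv_ar (Vect K) (runitor (Vect K) X) \<in> homset (Vect K) X (vsum X zero_space)"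
    unfolding eq using inverse_ar_of_runitor_Vect[OF assms] by (simp add: inverse_ar_of_def)
qed

section \<open>The axioms of a partial trace\<close>

lemma partial_trace_Vect:
  fixes K :: "('a, 'c) ring_scheme"
  assumes "field K"
  shows "partial_trace (Vect K :: (('a, 'b) vspace, ('a, 'b) arrow) smcat) vtrace"
    (is "partial_trace ?C _")
proof -
  interpret symmetric_monoidal_category ?C
    by (rule symmetric_monoidal_category_Vect) fact
  note vs = vectorspace_zero_space[OF assms] vectorspace_vsum
  show ?thesis
  proof
    fix X Y U f t
    assume "X \<in> Ob ?C" "Y \<in> Ob ?C" "U \<in> Ob ?C"
      "f \<in> homset ?C (X \<boxtimes>\<^bsub>?C\<^esub> U) (Y \<boxtimes>\<^bsub>?C\<^esub> U)" "vtrace U X Y f = Some t"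
    then show "t \<in> homset ?C X Y"
      by (simp add: vtrace_eq_Some_iff[of K])
  next
    fix X Y X' Y' U f g h
    assume ob: "X \<in> Ob ?C" "Y \<in> Ob ?C" "X' \<in> Ob ?C" "Y' \<in> Ob ?C" "U \<in> Ob ?C"
      and f: "f \<in> homset ?C (X \<boxtimes>\<^bsub>?C\<^esub> U) (Y \<boxtimes>\<^bsub>?C\<^esub> U)"
      and g: "g \<in> homset ?C X' X" and h: "h \<in> homset ?C Y Y'"
    show "map_option (\<lambda>t. h \<cdot>\<^bsub>?C\<^esub> t \<cdot>\<^bsub>?C\<^esub> g) (vtrace U X Y f) \<lesssim>
      vtrace U X' Y' ((h \<boxdot>\<^bsub>?C\<^esub> ident ?C U) \<cdot>\<^bsub>?C\<^esub> f \<cdot>\<^bsub>?C\<^esub> (g \<boxdot>\<^bsub>?C\<^esub> ident ?C U))"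
      (is "_ \<lesssim> vtrace U X' Y' ?F")
    proof (cases "vtrace U X Y f")
      case (Some t)
      have F: "?F \<in> homset ?C (X' \<boxtimes>\<^bsub>?C\<^esub> U) (Y' \<boxtimes>\<^bsub>?C\<^esub> U)"
        by (rule comp_hom tensor_hom ident_hom f g h ob)+
      have t: "t \<in> homset ?C X Y"
        and graph: "\<And>v w. v \<in> carrier X \<Longrightarrow> w \<in> carrier Y \<Longrightarrow>
          (\<exists>u\<in>carrier U. fn f (UPair v u) = UPair w u) \<longleftrightarrow> w = fn t v"
        using Some ob f by (simp_all add: vtrace_eq_Some_iff[of K])
      \<comment> \<open>Naturality: along \<open>?F\<close>, the point \<open>x\<close> is related
        exactly to the images under \<open>h\<close> of the points related to \<open>fn g x\<close>
        along \<open>f\<close>. As the trace of \<open>f\<close> is defined,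
        \<open>fn t (fn g x)\<close> is the only such point.\<close>
      have "(\<exists>u\<in>carrier U. fn ?F (UPair x u) = UPair z u) \<longleftrightarrow> z = fn h (fn t (fn g x))"
        if x: "x \<in> carrier X'" for x z
      proof -
        have gx: "fn g x \<in> carrier X" using g x by (auto elim!: homset_VectE)
        have tx: "fn t (fn g x) \<in> carrier Y" using t gx by (auto elim!: homset_VectE)
        have F_apply: "\<exists>y\<in>carrier Y. \<exists>u'\<in>carrier U. fn f (UPair (fn g x) u) = UPair y u' \<and>
            fn ?F (UPair x u) = UPair (fn h y) u'" if u: "u \<in> carrier U" for u
        proof -
          have "fn f (UPair (fn g x) u) \<in> carrier (vsum Y U)"
            using f gx u by (auto elim!: homset_VectE)
          then show ?thesis
            using f g h x u gx by (auto elim!: homset_VectE)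
        qed
        show ?thesis
          using graph[OF gx] F_apply tx by (metis univ.inject(2))
      qed
      moreover have "h \<cdot>\<^bsub>?C\<^esub> t \<cdot>\<^bsub>?C\<^esub> g \<in> homset ?C X' Y'"
        by (rule comp_hom t g h)+
      moreover have "fn (h \<cdot>\<^bsub>?C\<^esub> t \<cdot>\<^bsub>?C\<^esub> g) x = fn h (fn t (fn g x))" if "x \<in> carrier X'" for x
        using t g h that by (auto elim!: homset_VectE)
      ultimately have "vtrace U X' Y' ?F = Some (h \<cdot>\<^bsub>?C\<^esub> t \<cdot>\<^bsub>?C\<^esub> g)"
        using ob F[unfolded tensor_ob_Vect] by (intro vtrace_eq_SomeI[of K]) simp_all
      then show ?thesis
        using Some by (simp add: kleene_le_def)
    qed (simp add: kleene_le_def)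
  next
    fix X Y U U' f g
    assume ob: "X \<in> Ob ?C" "Y \<in> Ob ?C" "U \<in> Ob ?C" "U' \<in> Ob ?C"
      and f: "f \<in> homset ?C (X \<boxtimes>\<^bsub>?C\<^esub> U) (Y \<boxtimes>\<^bsub>?C\<^esub> U')" and g: "g \<in> homset ?C U' U"
    show "vtrace U X Y ((ident ?C Y \<boxdot>\<^bsub>?C\<^esub> g) \<cdot>\<^bsub>?C\<^esub> f) =
      vtrace U' X Y (f \<cdot>\<^bsub>?C\<^esub> (ident ?C X \<boxdot>\<^bsub>?C\<^esub> g))"
      (is "vtrace U X Y ?F = vtrace U' X Y ?F'")
    proof (rule vtrace_eqI[of K])
      show "vectorspace K X" "vectorspace K Y" "vectorspace K U" "vectorspace K U'"
        using ob by simp_all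
      have "?F \<in> homset ?C (X \<boxtimes>\<^bsub>?C\<^esub> U) (Y \<boxtimes>\<^bsub>?C\<^esub> U)"
        by (rule comp_hom tensor_hom ident_hom f g ob)+
      then show "?F \<in> homset ?C (vsum X U) (vsum Y U)" by (simp only: tensor_ob_Vect)
      have "?F' \<in> homset ?C (X \<boxtimes>\<^bsub>?C\<^esub> U') (Y \<boxtimes>\<^bsub>?C\<^esub> U')"
        by (rule comp_hom tensor_hom ident_hom f g ob)+
      then show "?F' \<in> homset ?C (vsum X U') (vsum Y U')" by (simp only: tensor_ob_Vect)
      fix x y
      assume x: "x \<in> carrier X" and "y \<in> carrier Y"
      have F_apply: "\<exists>y\<in>carrier Y. \<exists>u'\<in>carrier U'. fn f (UPair x u) = UPair y u' \<and>
          fn ?F (UPair x u) = UPair y (fn g u')" if u: "u \<in> carrier U" for u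
      proof -
        have "fn f (UPair x u) \<in> carrier (vsum Y U')"
          using f x u by (auto elim!: homset_VectE)
        then show ?thesis
          using f g x u by (auto elim!: homset_VectE)
      qed
      have F'_apply: "fn ?F' (UPair x u') = fn f (UPair x (fn g u'))" if "u' \<in> carrier U'" for u'
        using f g x that by (auto elim!: homset_VectE)
      \<comment> \<open>Dinaturality: a feedback value \<open>u\<close> of \<open>?F\<close> is
        turned into the second component \<open>u'\<close> of \<open>f\<close> at (x, u), which
        satisfies \<open>fn g u' = u\<close>. In the other direction, a feedback value
        \<open>u'\<close> of \<open>?F'\<close> is turned into \<open>fn g u'\<close>.\<close>
      show "(\<exists>u\<in>carrier U. fn ?F (UPair x u) = UPair y u) \<longleftrightarrow>
          (\<exists>u'\<in>carrier U'. fn ?F' (UPair x u') = UPair y u')"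
      proof
        assume "\<exists>u\<in>carrier U. fn ?F (UPair x u) = UPair y u"
        then obtain u where u: "u \<in> carrier U" "fn ?F (UPair x u) = UPair y u" by blast
        then obtain u' where "u' \<in> carrier U'" "fn f (UPair x u) = UPair y u'" "fn g u' = u"
          using F_apply[OF u(1)] by auto
        then show "\<exists>u'\<in>carrier U'. fn ?F' (UPair x u') = UPair y u'"
          using F'_apply by metis
      next
        assume "\<exists>u'\<in>carrier U'. fn ?F' (UPair x u') = UPair y u'"
        then obtain u' where u': "u' \<in> carrier U'" "fn f (UPair x (fn g u')) = UPair y u'"
          using F'_apply by metis
        moreover have "fn g u' \<in> carrier U"
          using g u'(1) by (rule homset_Vect_closed)
        ultimately show "\<exists>u\<in>carrier U. fn ?F (UPair x u) = UPair y u"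
          using F_apply by (metis univ.inject(2))
      qed
    qed
  next
    fix X Y f
    assume ob: "X \<in> Ob ?C" "Y \<in> Ob ?C"
      and f: "f \<in> homset ?C (X \<boxtimes>\<^bsub>?C\<^esub> unit_ob ?C) (Y \<boxtimes>\<^bsub>?C\<^esub> unit_ob ?C)"
    have inv: "inv_ar ?C (runitor ?C X) \<in> homset ?C X (X \<boxtimes>\<^bsub>?C\<^esub> unit_ob ?C)"
      using runitor_inverse_Vect(2)[OF assms] ob by simp
    have "vtrace zero_space X Y f = Some (runitor ?C Y \<cdot>\<^bsub>?C\<^esub> f \<cdot>\<^bsub>?C\<^esub> inv_ar ?C (runitor ?C X))"
      (is "_ = Some ?t")
    proof (rule vtrace_eq_SomeI[of K])
      show X: "vectorspace K X" and "vectorspace K Y" "vectorspace K zero_space"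
        using ob by (simp_all add: vs)
      show "f \<in> homset ?C (vsum X zero_space) (vsum Y zero_space)"
        using f by simp
      show "?t \<in> homset ?C X Y"
        by (rule comp_hom inv runitor_hom f ob)+
      fix x y
      assume x: "x \<in> carrier X" and "y \<in> carrier Y"
      have fx: "fn f (UPair x Point) \<in> carrier (vsum Y zero_space)"
        using f x by (auto elim!: homset_VectE)
      have "fn ?t x = ufst (fn f (UPair x Point))"
        unfolding runitor_inverse_Vect(1)[OF assms X]
        using f x fx by (auto elim!: homset_VectE)
      \<comment> \<open>Vanishing I: the only candidate feedback value is \<open>Point\<close>, and
        it is returned unchanged because the second component of the output also lies in the zero
        space.\<close>
      then show "(\<exists>u\<in>carrier zero_space. fn f (UPair x u) = UPair y u) \<longleftrightarrow> y = fn ?t x"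
        using fx by auto
    qed
    then show "vtrace (unit_ob ?C) X Y f = Some (runitor ?C Y \<cdot>\<^bsub>?C\<^esub> f \<cdot>\<^bsub>?C\<^esub> inv_ar ?C (runitor ?C X))"
      by (simp only: unit_ob_Vect)
  next
    fix X Y U V g t
    assume ob: "X \<in> Ob ?C" "Y \<in> Ob ?C" "U \<in> Ob ?C" "V \<in> Ob ?C"
      and g: "g \<in> homset ?C ((X \<boxtimes>\<^bsub>?C\<^esub> U) \<boxtimes>\<^bsub>?C\<^esub> V) ((Y \<boxtimes>\<^bsub>?C\<^esub> U) \<boxtimes>\<^bsub>?C\<^esub> V)"
      and tr: "vtrace V (X \<boxtimes>\<^bsub>?C\<^esub> U) (Y \<boxtimes>\<^bsub>?C\<^esub> U) g = Some t"
    have sp: "vectorspace K X" "vectorspace K Y" "vectorspace K U" "vectorspace K V"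
      using ob by simp_all
    have inv: "inv_ar ?C (associator ?C X U V) \<in>
        homset ?C (X \<boxtimes>\<^bsub>?C\<^esub> (U \<boxtimes>\<^bsub>?C\<^esub> V)) ((X \<boxtimes>\<^bsub>?C\<^esub> U) \<boxtimes>\<^bsub>?C\<^esub> V)"
      using associator_inverse_Vect(2)[OF sp(1,3,4)] by simp
    have t: "t \<in> homset ?C (vsum X U) (vsum Y U)"
      and graph: "\<And>p q. p \<in> carrier (vsum X U) \<Longrightarrow> q \<in> carrier (vsum Y U) \<Longrightarrow>
        (\<exists>v\<in>carrier V. fn g (UPair p v) = UPair q v) \<longleftrightarrow> q = fn t p"
      using tr sp g by (simp_all add: vtrace_eq_Some_iff[of K] vectorspace_vsum)
    have "vtrace (vsum U V) X Y (associator ?C Y U V \<cdot>\<^bsub>?C\<^esub> g \<cdot>\<^bsub>?C\<^esub> inv_ar ?C (associator ?C X U V))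
        = vtrace U X Y t" (is "vtrace _ _ _ ?F = _")
    proof (rule vtrace_eqI[of K])
      show "vectorspace K X" "vectorspace K Y" "vectorspace K U" "vectorspace K (vsum U V)"
        using sp by (simp_all add: vs)
      have "?F \<in> homset ?C (X \<boxtimes>\<^bsub>?C\<^esub> (U \<boxtimes>\<^bsub>?C\<^esub> V)) (Y \<boxtimes>\<^bsub>?C\<^esub> (U \<boxtimes>\<^bsub>?C\<^esub> V))"
        by (rule comp_hom inv associator_hom g ob)+
      then show "?F \<in> homset ?C (vsum X (vsum U V)) (vsum Y (vsum U V))"
        by (simp only: tensor_ob_Vect)
      show "t \<in> homset ?C (vsum X U) (vsum Y U)" by fact
      fix x y
      assume x: "x \<in> carrier X" and y: "y \<in> carrier Y"
      have F_apply: "\<exists>y\<in>carrier Y. \<exists>u'\<in>carrier U. \<exists>v'\<in>carrier V.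
          fn g (UPair (UPair x u) v) = UPair (UPair y u') v' \<and>
          fn ?F (UPair x (UPair u v)) = UPair y (UPair u' v')"
        if uv: "u \<in> carrier U" "v \<in> carrier V" for u v
      proof -
        have "fn g (UPair (UPair x u) v) \<in> carrier (vsum (vsum Y U) V)"
          using g x uv by (auto elim!: homset_VectE)
        then show ?thesis
          unfolding associator_inverse_Vect(1)[OF sp(1,3,4)]
          using g x uv by (auto elim!: homset_VectE)
      qed
      \<comment> \<open>Vanishing II: a joint feedback value is a pair of \<open>u\<close> and
        \<open>v\<close>. Reassociating makes it a fixed point condition on \<open>g\<close> in both
        components; the inner one is then eliminated.\<close>
      have "(\<exists>p\<in>carrier (vsum U V). fn ?F (UPair x p) = UPair y p) \<longleftrightarrow>
          (\<exists>u\<in>carrier U. \<exists>v\<in>carrier V. fn ?F (UPair x (UPair u v)) = UPair y (UPair u v))"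
        by (rule Bex_vsum)
      also have "\<dots> \<longleftrightarrow>
          (\<exists>u\<in>carrier U. \<exists>v\<in>carrier V. fn g (UPair (UPair x u) v) = UPair (UPair y u) v)"
      proof (intro bex_cong refl)
        fix u v
        assume "u \<in> carrier U" "v \<in> carrier V"
        then obtain y' u' v' where "fn g (UPair (UPair x u) v) = UPair (UPair y' u') v'"
          "fn ?F (UPair x (UPair u v)) = UPair y' (UPair u' v')"
          using F_apply by blast
        then show "fn ?F (UPair x (UPair u v)) = UPair y (UPair u v) \<longleftrightarrow>
            fn g (UPair (UPair x u) v) = UPair (UPair y u) v"
          by (simp only: univ.inject) blast
      qed
      \<comment> \<open>Definedness of the inner trace enters here: for fixed \<open>u\<close>, its
        graph replaces the search for \<open>v\<close> by an equation for \<open>t\<close>, with the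
        same \<open>u\<close> in input and output.\<close>
      also have "\<dots> \<longleftrightarrow> (\<exists>u\<in>carrier U. fn t (UPair x u) = UPair y u)"
        using graph[of "UPair x _" "UPair y _"] x y by (intro bex_cong refl) auto
      finally show "(\<exists>p\<in>carrier (vsum U V). fn ?F (UPair x p) = UPair y p) \<longleftrightarrow>
          (\<exists>u\<in>carrier U. fn t (UPair x u) = UPair y u)" .
    qed
    then show "vtrace (U \<boxtimes>\<^bsub>?C\<^esub> V) X Y
        (associator ?C Y U V \<cdot>\<^bsub>?C\<^esub> g \<cdot>\<^bsub>?C\<^esub> inv_ar ?C (associator ?C X U V)) = vtrace U X Y t"
      by (simp only: tensor_ob_Vect)
  next
    fix X Y U W Z f g
    assume ob: "X \<in> Ob ?C" "Y \<in> Ob ?C" "U \<in> Ob ?C" "W \<in> Ob ?C" "Z \<in> Ob ?C"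
      and f: "f \<in> homset ?C (X \<boxtimes>\<^bsub>?C\<^esub> U) (Y \<boxtimes>\<^bsub>?C\<^esub> U)" and g: "g \<in> homset ?C W Z"
    have sp: "vectorspace K X" "vectorspace K Y" "vectorspace K U" "vectorspace K W"
        "vectorspace K Z"
      using ob by simp_all
    have inv: "inv_ar ?C (associator ?C Z Y U) \<in>
        homset ?C (Z \<boxtimes>\<^bsub>?C\<^esub> (Y \<boxtimes>\<^bsub>?C\<^esub> U)) ((Z \<boxtimes>\<^bsub>?C\<^esub> Y) \<boxtimes>\<^bsub>?C\<^esub> U)"
      using associator_inverse_Vect(2)[OF sp(5,2,3)] by simp
    show "map_option (\<lambda>t. g \<boxdot>\<^bsub>?C\<^esub> t) (vtrace U X Y f) \<lesssim>
      vtrace U (W \<boxtimes>\<^bsub>?C\<^esub> X) (Z \<boxtimes>\<^bsub>?C\<^esub> Y)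
        (inv_ar ?C (associator ?C Z Y U) \<cdot>\<^bsub>?C\<^esub> (g \<boxdot>\<^bsub>?C\<^esub> f) \<cdot>\<^bsub>?C\<^esub> associator ?C W X U)"
      (is "_ \<lesssim> vtrace U _ _ ?F")
    proof (cases "vtrace U X Y f")
      case (Some t)
      have t: "t \<in> homset ?C X Y"
        and graph: "\<And>v w. v \<in> carrier X \<Longrightarrow> w \<in> carrier Y \<Longrightarrow>
          (\<exists>u\<in>carrier U. fn f (UPair v u) = UPair w u) \<longleftrightarrow> w = fn t v"
        using Some ob f by (simp_all add: vtrace_eq_Some_iff[of K])
      have "vtrace U (vsum W X) (vsum Z Y) ?F = Some (g \<boxdot>\<^bsub>?C\<^esub> t)"
      proof (rule vtrace_eq_SomeI[of K])
        show "vectorspace K (vsum W X)" "vectorspace K (vsum Z Y)" "vectorspace K U"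
          using sp by (simp_all add: vs)
        have "?F \<in> homset ?C ((W \<boxtimes>\<^bsub>?C\<^esub> X) \<boxtimes>\<^bsub>?C\<^esub> U) ((Z \<boxtimes>\<^bsub>?C\<^esub> Y) \<boxtimes>\<^bsub>?C\<^esub> U)"
          by (rule comp_hom inv associator_hom tensor_hom f g ob)+
        then show "?F \<in> homset ?C (vsum (vsum W X) U) (vsum (vsum Z Y) U)"
          by (simp only: tensor_ob_Vect)
        show "g \<boxdot>\<^bsub>?C\<^esub> t \<in> homset ?C (vsum W X) (vsum Z Y)"
          using tensor_hom[OF g t] by (simp only: tensor_ob_Vect)
        fix p q
        assume "p \<in> carrier (vsum W X)" and "q \<in> carrier (vsum Z Y)"
        then obtain w x z y where p: "p = UPair w x" "w \<in> carrier W" "x \<in> carrier X"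
          and q: "q = UPair z y" "z \<in> carrier Z" "y \<in> carrier Y"
          by blast
        have F_apply: "\<exists>y\<in>carrier Y. \<exists>u'\<in>carrier U. fn f (UPair x u) = UPair y u' \<and>
            fn ?F (UPair p u) = UPair (UPair (fn g w) y) u'" if u: "u \<in> carrier U" for u
        proof -
          have "fn f (UPair x u) \<in> carrier (vsum Y U)"
            using f p u by (auto elim!: homset_VectE)
          then show ?thesis
            unfolding associator_inverse_Vect(1)[OF sp(5,2,3)]
            using f g p u by (auto elim!: homset_VectE)
        qed
        \<comment> \<open>Superposing: \<open>g\<close> takes no part in the feedback, so its
          equation can be pulled out of the quantifier over \<open>u\<close>.\<close>
        have "(\<exists>u\<in>carrier U. fn ?F (UPair p u) = UPair q u) \<longleftrightarrow>
            z = fn g w \<and> (\<exists>u\<in>carrier U. fn f (UPair x u) = UPair y u)"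
        proof -
          have "fn ?F (UPair p u) = UPair q u \<longleftrightarrow> z = fn g w \<and> fn f (UPair x u) = UPair y u"
            if u: "u \<in> carrier U" for u
          proof -
            obtain y' u' where "fn f (UPair x u) = UPair y' u'"
              "fn ?F (UPair p u) = UPair (UPair (fn g w) y') u'"
              using F_apply[OF u] by blast
            then show ?thesis
              unfolding q(1) by (simp only: univ.inject) blast
          qed
          then show ?thesis by (metis (no_types, lifting))
        qed
        also have "\<dots> \<longleftrightarrow> z = fn g w \<and> y = fn t x"
          using graph p q by simp
        also have "\<dots> \<longleftrightarrow> q = fn (g \<boxdot>\<^bsub>?C\<^esub> t) p"
          using g t p q by (auto elim!: homset_VectE)
        finally show "(\<exists>u\<in>carrier U. fn ?F (UPair p u) = UPair q u) \<longleftrightarrow> q = fn (g \<boxdot>\<^bsub>?C\<^esub> t) p" .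
      qed
      then show ?thesis
        unfolding Some by (simp add: kleene_le_def)
    qed (simp add: kleene_le_def)
  next
    fix U
    assume ob: "U \<in> Ob ?C"
    show "vtrace U U U (symmetry ?C U U) = Some (ident ?C U)"
    proof (rule vtrace_eq_SomeI[of K])
      show "vectorspace K U" "vectorspace K U" "vectorspace K U"
        using ob by simp_all
      show "symmetry ?C U U \<in> homset ?C (vsum U U) (vsum U U)"
        using symmetry_hom[OF ob ob] by simp
      show "ident ?C U \<in> homset ?C U U"
        using ob by (rule ident_hom)
    \<comment> \<open>Yanking: the swap sends (x, u) to (u, x). Feeding back \<open>u\<close> forces
      \<open>u\<close> to be x, and the output is that same element.\<close>
    qed auto
  qed
qed

text \<open>The choice operator in \<open>vtrace\<close> fixes one solution silently; the second
  conjunct expresses that every other solution gives the same value.\<close>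

theorem theorem4p2p11:
  fixes K :: "('a, 'c) ring_scheme"
  assumes "field K"
  shows "partial_trace (Vect K :: (('a, 'b) vspace, ('a, 'b) arrow) smcat) vtrace \<and>
    (\<forall>(U :: ('a, 'b) vspace) V W f t v u.
       vectorspace K U \<longrightarrow> vectorspace K V \<longrightarrow> vectorspace K W \<longrightarrow>
       f \<in> homset (Vect K) (vsum V U) (vsum W U) \<longrightarrow>
       vtrace U V W f = Some t \<longrightarrow>
       v \<in> carrier V \<longrightarrow> u \<in> carrier U \<longrightarrow> id_minus_comp22 U V f u = comp21 U f v \<longrightarrow>
       fn t v = comp11 U f v \<oplus>\<^bsub>W\<^esub> comp12 V f u)"
  using partial_trace_Vect[OF assms] vtrace_apply[of K] by blast

end
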